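(* Let $f\in\mathbb{C}[z]$ be a polynomial of degree $n\ge1$ with $f(0)\neq0$. For every $\theta\in\mathbb{T}$, $$N_\theta(f)\le\sqrt{2}\,\sqrt{\mathcal{H}[f]}\;n,$$ and in particular $N_+(f)\le\sqrt2\sqrt{\mathcal{H}[f]}\,n$ and $N_-(f)\le\sqrt2\sqrt{\mathcal{H}[f]}\,n$. These inequalities are sharp: the constant $\sqrt2$ cannot be replaced by any smaller constant.
   Context: $\mathbb{T}=\mathbb{R}/\mathbb{Z}$. Writing $f(z)=\sum_{k=0}^na_kz^k$, the height is $\mathcal{H}[f]=\frac1n\log\frac{\max_{|z|=1}|f(z)|}{\sqrt{|a_0a_n|}}$. $N_\theta(f)$ is the number of roots (with multiplicity) of $f$ of the form $re^{2\pi i\theta}$ with $r>0$; $N_+(f)$ and $N_-(f)$ are the numbers of positive and negative real roots of $f$ (with multiplicity). *)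

theory Defs
  imports "HOL-Analysis.Analysis" "HOL-Computational_Algebra.Polynomial"
begin

definition poly_height :: "complex poly \<Rightarrow> real" where
  "poly_height f = ln ((SUP z\<in>sphere 0 1. cmod (poly f z)) /
      sqrt (cmod (coeff f 0) * cmod (lead_coeff f))) / real (degree f)"

text \<open>N_theta(f): number of roots (with multiplicity) of the form r e^{2 pi i theta}, r > 0.
  theta ranges over reals, representing R/Z (the definition is 1-periodic).\<close>
definition N_theta :: "real \<Rightarrow> complex poly \<Rightarrow> nat" where
  "N_theta \<theta> f = (\<Sum>z\<in>{z. poly f z = 0 \<and> (\<exists>r>0. z = complex_of_real r * cis (2 * pi * \<theta>))}. order z f)"

definition N_pos :: "complex poly \<Rightarrow> nat" where
  "N_pos f = (\<Sum>z\<in>{z. poly f z = 0 \<and> z \<in> \<real> \<and> Re z > 0}. order z f)"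

definition N_neg :: "complex poly \<Rightarrow> nat" where
  "N_neg f = (\<Sum>z\<in>{z. poly f z = 0 \<and> z \<in> \<real> \<and> Re z < 0}. order z f)"

end

theory Submission
  imports Defs "HOL-Computational_Algebra.Fundamental_Theorem_Algebra" "HOL-Real_Asymp.Real_Asymp"
begin

text \<open>
  Projecting every root radially to the unit circle (Schur) gives a monic \<open>g\<close> with
  \<open>max |g| \<le> M = max |f| / sqrt |a\<^sub>0 a\<^sub>n|\<close> on the circle, and after a rotation \<open>g\<close> has a root of order
  \<open>b = N_theta \<theta> f\<close> at 1.  The least squared \<open>L\<^sup>2\<close> norm on the circle of such a polynomial is
  \<open>P = (n + b)! (n - b)! / (n!)\<^sup>2 \<ge> exp (2b\<^sup>2 / (2n + 1))\<close>.  Hence \<open>2 ln M \<ge> 2b\<^sup>2 / (2n + 1)\<close>, and the same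
  bound for \<open>g ^ k\<close> with \<open>k \<rightarrow> \<infinity>\<close> improves this to \<open>b\<^sup>2 \<le> 2 n ln M\<close>.

  The \<open>L\<^sup>2\<close> minimiser is explicit.  Up to sign its constant coefficient is \<open>b / n\<close> times the leading one and its
  maximum is at most \<open>sqrt (n + 1)\<close> times its \<open>L\<^sup>2\<close> norm, so up to logarithmic terms it has \<open>n * H = (ln P) / 2\<close>.
  With \<open>n = k\<^sup>3\<close> and \<open>b = k\<^sup>2\<close> those terms are negligible and \<open>ln P\<close> is asymptotic to \<open>b\<^sup>2 / n\<close>.
\<close>

section \<open>Finite differences and summation by parts\<close>

text \<open>One backward difference \<open>r\<close> of \<open>q\<close> cancels the leading term,
  since a shift preserves the leading coefficient. Pascal's rule writes the difference of order
  \<open>Suc d\<close> of \<open>q\<close> as the one of order \<open>d\<close> of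
  \<open>r\<close>.\<close>

lemma backward_differences_poly_eq_0:
  fixes q :: "'a::idom poly"
  assumes "q = 0 \<or> degree q < d"
  shows "(\<Sum>i\<le>d. (-1) ^ i * of_nat (d choose i) * poly q (x - of_nat i)) = 0"
  using assms
proof (induction d arbitrary: q)
  case 0
  then show ?case by simp
next
  case (Suc d)
  define r where "r = q - q \<circ>\<^sub>p [:-1, 1:]"
  have "r = 0 \<or> degree r < d"
  proof (cases "degree q = 0")
    case True
    then obtain c where "q = [:c:]"
      using degree_eq_zeroE by blast
    then show ?thesis
      by (simp add: r_def)
  next
    case False
    have deg: "degree (q \<circ>\<^sub>p [:-1, 1:]) = degree q"
      by (simp add: degree_pcompose)
    have "coeff (q \<circ>\<^sub>p [:-1, 1:]) (degree q) = lead_coeff q"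
      using lead_coeff_comp[of "[:-1, 1:]" q] deg by simp
    then have "coeff r (degree q) = 0"
      by (simp add: r_def)
    moreover have "degree r \<le> degree q"
      unfolding r_def by (rule degree_diff_le) (simp_all add: deg)
    ultimately have "r = 0 \<or> degree r < degree q"
      by (metis eq_zero_or_degree_less)
    then show ?thesis
      using Suc.prems False by auto
  qed
  note IH = Suc.IH[OF this]
  let ?f = "\<lambda>i. poly q (x - of_nat i)"
  have "(\<Sum>i\<le>Suc d. (-1) ^ i * of_nat (Suc d choose i) * ?f i)
      = ?f 0 + (\<Sum>i\<le>d. (-1) ^ Suc i * of_nat (Suc d choose Suc i) * ?f (Suc i))"
    by (subst sum.atMost_Suc_shift) simp
  also have "(\<Sum>i\<le>d. (-1) ^ Suc i * of_nat (Suc d choose Suc i) * ?f (Suc i))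
      = (\<Sum>i\<le>d. (-1) ^ Suc i * of_nat (d choose Suc i) * ?f (Suc i))
      - (\<Sum>i\<le>d. (-1) ^ i * of_nat (d choose i) * ?f (Suc i))"
    unfolding sum_subtractf[symmetric] by (intro sum.cong refl) (simp add: algebra_simps)
  also have "?f 0 + \<dots> = (\<Sum>i\<le>Suc d. (-1) ^ i * of_nat (d choose i) * ?f i)
      - (\<Sum>i\<le>d. (-1) ^ i * of_nat (d choose i) * ?f (Suc i))"
    by (subst sum.atMost_Suc_shift) simp
  also have "\<dots> = (\<Sum>i\<le>d. (-1) ^ i * of_nat (d choose i) * ?f i)
      - (\<Sum>i\<le>d. (-1) ^ i * of_nat (d choose i) * ?f (Suc i))"
    by (simp add: binomial_eq_0)
  also have "\<dots> = (\<Sum>i\<le>d. (-1) ^ i * of_nat (d choose i) * poly r (x - of_nat i))"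
    by (simp add: r_def poly_pcompose sum_subtractf[symmetric] algebra_simps)
  finally show ?case
    using IH by simp
qed

text \<open>For the bilinear pairing of coefficient sequences, multiplication by
  \<open>z - 1\<close> is adjoint to multiplication by \<open>1 - z\<close>, up to an index shift by
  one. Iterating this \<open>b\<close> times gives the shift \<open>k + b\<close>; the induction
  absorbs one factor into \<open>A\<close> and raises \<open>K\<close> accordingly.\<close>

lemma sum_coeff_mult_linear_power:
  fixes A B :: "'a::comm_ring_1 poly"
  assumes "degree A \<le> K"
  shows "(\<Sum>k\<le>K + b. coeff ([:-1, 1:] ^ b * A) k * coeff B k)
       = (\<Sum>k\<le>K. coeff A k * coeff ([:1, -1:] ^ b * B) (k + b))"
  using assms
proof (induction b arbitrary: A K)
  case 0
  then show ?case by simp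
next
  case (Suc b)
  define C where "C = [:1, -1:] ^ b * B"
  have "degree ([:-1, 1:] * A) \<le> Suc K"
    using degree_mult_le[of "[:-1, 1:]" A] Suc.prems by simp
  from Suc.IH[OF this]
  have "(\<Sum>k\<le>K + Suc b. coeff ([:-1, 1:] ^ Suc b * A) k * coeff B k)
      = (\<Sum>k\<le>Suc K. coeff ([:-1, 1:] * A) k * coeff C (k + b))"
    by (simp add: C_def mult_ac del: mult_pCons_left mult_pCons_right)
  also have "\<dots> = (\<Sum>k\<le>Suc K. coeff (pCons 0 A) k * coeff C (k + b))
                - (\<Sum>k\<le>Suc K. coeff A k * coeff C (k + b))"
    unfolding sum_subtractf[symmetric] by (intro sum.cong refl) (simp add: algebra_simps)
  also have "(\<Sum>k\<le>Suc K. coeff (pCons 0 A) k * coeff C (k + b))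
           = (\<Sum>k\<le>K. coeff A k * coeff C (Suc k + b))"
    by (subst sum.atMost_Suc_shift) simp
  also have "(\<Sum>k\<le>Suc K. coeff A k * coeff C (k + b)) = (\<Sum>k\<le>K. coeff A k * coeff C (k + b))"
    using Suc.prems by (simp add: coeff_eq_0)
  also have "(\<Sum>k\<le>K. coeff A k * coeff C (Suc k + b)) - (\<Sum>k\<le>K. coeff A k * coeff C (k + b))
           = (\<Sum>k\<le>K. coeff A k * coeff ([:1, -1:] * C) (k + Suc b))"
    by (simp add: sum_subtractf[symmetric] algebra_simps)
  finally show ?case
    by (simp add: C_def mult_ac del: mult_pCons_left mult_pCons_right)
qed

lemma fact_add_eq_prod:
  "fact (k + b) = fact k * (\<Prod>i=1..b. of_nat (k + i) :: 'a::{comm_semiring_1,semiring_char_0})"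
  by (induction b) (simp_all add: algebra_simps)

section \<open>Discrete Parseval on the unit circle\<close>

lemma sum_cis_roots_of_unity:
  fixes k l n :: nat
  assumes "k \<le> n" "l \<le> n" "k \<noteq> l"
  defines "w \<equiv> \<lambda>j. exp (2 * of_real pi * \<i> * of_nat j / of_nat (Suc n)) :: complex"
  shows "(\<Sum>j\<le>n. w j ^ k * cnj (w j ^ l)) = 0"
proof -
  define \<zeta> where "\<zeta> = w k / w l"
  \<comment> \<open>Exchanging index and exponent turns the sum over \<open>j\<close> into a
    geometric series in \<open>\<zeta>\<close>, a root of unity of order dividing
    \<open>n + 1\<close> and different from 1.\<close>
  have w_pow: "w j ^ i = w i ^ j" for i j
    unfolding w_def by (simp add: exp_of_nat_mult[symmetric] mult_ac)
  have "norm (w j) = 1" for j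
    by (simp add: w_def)
  then have cnj_w: "cnj (w j) = inverse (w j)" for j
    by (simp add: complex_inverse complex_cnj complex_eq_iff inverse_complex.sel cmod_def)
  have "\<zeta> \<noteq> 1"
    using complex_root_unity_eq[of "Suc n" k l] assms by (auto simp: \<zeta>_def w_def)
  have "\<zeta> ^ Suc n = 1"
    unfolding \<zeta>_def power_divide w_def by (subst (1 2) complex_root_unity) simp_all
  have "(\<Sum>j\<le>n. w j ^ k * cnj (w j ^ l)) = (\<Sum>j\<le>n. \<zeta> ^ j)"
    by (intro sum.cong) (simp_all add: \<zeta>_def power_divide w_pow[of _ k] w_pow[of _ l] cnj_w
          power_inverse field_simps)
  also have "\<dots> = 0"
    using sum_gp_basic[of \<zeta> n] \<open>\<zeta> \<noteq> 1\<close> \<open>\<zeta> ^ Suc n = 1\<close> by simp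
  finally show ?thesis .
qed

text \<open>Averaging \<open>|g|^2\<close> over the \<open>n + 1\<close> roots of unity replaces the
  integral over the circle. These points suffice because distinct exponents up to \<open>n\<close>
  stay distinct modulo \<open>n + 1\<close>.\<close>

lemma sum_norm_coeff_sq_le:
  fixes g :: "complex poly"
  assumes "degree g \<le> n" and M: "\<And>z. norm z = 1 \<Longrightarrow> norm (poly g z) \<le> M"
  shows "(\<Sum>k\<le>n. (norm (coeff g k))\<^sup>2) \<le> M\<^sup>2"
proof -
  define w :: "nat \<Rightarrow> complex"
    where "w = (\<lambda>j. exp (2 * of_real pi * \<i> * of_nat j / of_nat (Suc n)))"
  define a where "a = coeff g"
  have w1: "norm (w j) = 1" for j
    by (simp add: w_def)
  have gw: "poly g z = (\<Sum>k\<le>n. a k * z ^ k)" for z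
    unfolding a_def poly_altdef
    using assms(1) by (intro sum.mono_neutral_left) (auto simp: coeff_eq_0)
  have inner: "(\<Sum>j\<le>n. w j ^ k * cnj (w j ^ l)) = (if k = l then of_nat (Suc n) else 0)"
    if "k \<le> n" "l \<le> n" for k l
  proof (cases "k = l")
    case True
    have "w j ^ k * cnj (w j ^ k) = 1" for j
      using w1[of j] by (metis complex_norm_square norm_power of_real_1 power_one)
    then show ?thesis using True by simp
  next
    case False
    then show ?thesis
      using sum_cis_roots_of_unity[OF that False] by (simp add: w_def)
  qed
  have "of_real (\<Sum>j\<le>n. (norm (poly g (w j)))\<^sup>2)
      = (\<Sum>j\<le>n. (\<Sum>k\<le>n. a k * w j ^ k) * cnj (\<Sum>l\<le>n. a l * w j ^ l))"
    by (simp only: of_real_sum complex_norm_square gw)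
  also have "\<dots> = (\<Sum>j\<le>n. \<Sum>k\<le>n. \<Sum>l\<le>n. a k * cnj (a l) * (w j ^ k * cnj (w j ^ l)))"
    by (simp add: sum_product mult_ac)
  also have "\<dots> = (\<Sum>k\<le>n. \<Sum>j\<le>n. \<Sum>l\<le>n. a k * cnj (a l) * (w j ^ k * cnj (w j ^ l)))"
    by (rule sum.swap)
  also have "\<dots> = (\<Sum>k\<le>n. \<Sum>l\<le>n. \<Sum>j\<le>n. a k * cnj (a l) * (w j ^ k * cnj (w j ^ l)))"
    by (intro sum.cong refl sum.swap)
  also have "\<dots> = (\<Sum>k\<le>n. \<Sum>l\<le>n. a k * cnj (a l) * (if k = l then of_nat (Suc n) else 0))"
    by (intro sum.cong refl, subst sum_distrib_left[symmetric], subst inner) auto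
  also have "\<dots> = (\<Sum>k\<le>n. a k * cnj (a k) * of_nat (Suc n))"
    by (simp add: if_distrib cong: if_cong)
  also have "\<dots> = of_real (of_nat (Suc n) * (\<Sum>k\<le>n. (norm (a k))\<^sup>2))"
    by (simp add: complex_norm_square[symmetric] sum_distrib_left mult_ac)
  finally have "real (Suc n) * (\<Sum>k\<le>n. (norm (a k))\<^sup>2) = (\<Sum>j\<le>n. (norm (poly g (w j)))\<^sup>2)"
    by (simp only: of_real_eq_iff)
  also have "\<dots> \<le> (\<Sum>j\<le>n. M\<^sup>2)"
    using M w1 by (intro sum_mono power_mono) auto
  finally show ?thesis
    by (simp add: a_def)
qed

section \<open>The extremal polynomial and its reproducing property\<close>

text \<open>
  The minimiser is \<open>(z - 1) ^ Suc a\<close> times the orthogonal polynomial of degree \<open>m\<close> for the circle weight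
  \<open>|1 - z| ^ (2 * Suc a)\<close>, whose \<open>k\<close>-th coefficient is proportional to \<open>\<Prod>i=1..a+1. (k + i)\<close> times
  \<open>\<Prod>i=1..a. (m - k + i)\<close>.  Its order of vanishing at 1 is \<open>Suc a\<close> and its degree \<open>m + Suc a\<close>.
\<close>

definition extremal_weight :: "nat \<Rightarrow> nat \<Rightarrow> complex poly" where
  "extremal_weight a m = (\<Prod>i=1..Suc a. [:of_nat i, 1:]) * (\<Prod>i=1..a. [:of_nat (m + i), -1:])"

definition extremal_cofactor :: "nat \<Rightarrow> nat \<Rightarrow> complex poly" where
  "extremal_cofactor a m = (\<Sum>k\<le>m. monom (poly (extremal_weight a m) (of_nat k)) k)"

definition extremal_poly :: "nat \<Rightarrow> nat \<Rightarrow> complex poly" where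
  "extremal_poly a m = [:-1, 1:] ^ Suc a * extremal_cofactor a m"

lemma poly_extremal_weight:
  "poly (extremal_weight a m) x = (\<Prod>i=1..Suc a. of_nat i + x) * (\<Prod>i=1..a. of_nat (m + i) - x)"
  by (simp add: extremal_weight_def poly_prod del: prod.cl_ivl_Suc)

lemma degree_extremal_weight: "degree (extremal_weight a m) < 2 * Suc a"
proof -
  have "degree (\<Prod>i=1..Suc a. [:of_nat i, 1::complex:]) \<le> Suc a"
    by (rule order_trans[OF degree_prod_sum_le]) simp_all
  moreover have "degree (\<Prod>i=1..a. [:of_nat (m + i), -1::complex:]) \<le> a"
    by (rule order_trans[OF degree_prod_sum_le]) simp_all
  ultimately show ?thesis
    using degree_mult_le[of "\<Prod>i=1..Suc a. [:of_nat i, 1::complex:]"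
        "\<Prod>i=1..a. [:of_nat (m + i), -1::complex:]"]
    by (simp add: extremal_weight_def)
qed

lemma poly_extremal_weight_eq_0_left:
  assumes "1 \<le> t" "t \<le> Suc a"
  shows "poly (extremal_weight a m) (- of_nat t) = 0"
proof -
  have "(\<Prod>i=1..Suc a. of_nat i + - of_nat t :: complex) = 0"
    using assms by (intro prod_zero bexI[of _ t]) simp_all
  then show ?thesis
    by (simp only: poly_extremal_weight mult_zero_left)
qed

lemma poly_extremal_weight_eq_0_right:
  assumes "m < k" "k \<le> m + a"
  shows "poly (extremal_weight a m) (of_nat k) = 0"
proof -
  have "k - m \<in> {1..a}" "of_nat (m + (k - m)) - of_nat k = (0::complex)"
    using assms by auto
  then have "(\<Prod>i=1..a. of_nat (m + i) - of_nat k :: complex) = 0"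
    by (intro prod_zero) blast+
  then show ?thesis
    by (simp add: poly_extremal_weight)
qed

lemma poly_extremal_weight_0:
  "poly (extremal_weight a m) 0 = fact (Suc a) * (fact (m + a) / fact m)"
  using fact_add_eq_prod[of 0 "Suc a", where 'a = complex]
        fact_add_eq_prod[of m a, where 'a = complex]
  by (simp add: poly_extremal_weight del: prod.cl_ivl_Suc fact_Suc)

lemma poly_extremal_weight_m:
  "poly (extremal_weight a m) (of_nat m) = fact (m + Suc a) / fact m * fact a"
  using fact_add_eq_prod[of m "Suc a", where 'a = complex]
        fact_add_eq_prod[of 0 a, where 'a = complex]
  by (simp add: poly_extremal_weight add.commute)

text \<open>The point \<open>m + Suc a\<close> comes right after the zeros at
  \<open>m + 1, \<dots>, m + a\<close>. The value there is the only term that the truncation of the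
  cofactor at degree \<open>m\<close> loses.\<close>

lemma poly_extremal_weight_end:
  "poly (extremal_weight a m) (of_nat (m + Suc a)) =
     (-1) ^ a * (fact (m + 2 * Suc a) / fact (m + Suc a) * fact a)"
proof -
  have "(\<Prod>i=1..Suc a. of_nat i + of_nat (m + Suc a) :: complex) =
        fact (m + 2 * Suc a) / fact (m + Suc a)"
    using fact_add_eq_prod[of "m + Suc a" "Suc a", where 'a = complex]
    by (simp add: add_ac mult_2 del: prod.cl_ivl_Suc fact_Suc)
  moreover have "(\<Prod>i=1..a. of_nat (m + i) - of_nat (m + Suc a) :: complex) =
        (\<Prod>i=1..a. - of_nat (Suc a - i))"
    by (intro prod.cong) (auto simp: of_nat_diff)
  moreover have "(\<Prod>i=1..a. - of_nat (Suc a - i) :: complex) = (-1) ^ a * (\<Prod>i=1..a. of_nat (Suc a - i))"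
    using prod.distrib[of "\<lambda>_. -1" "\<lambda>i. of_nat (Suc a - i) :: complex" "{1..a}"] by simp
  moreover have "(\<Prod>i=1..a. of_nat (Suc a - i) :: complex) = fact a"
    using prod.atLeastAtMost_rev[of "\<lambda>i. of_nat i :: complex" 1 a]
    by (simp add: fact_prod del: of_nat_diff)
  ultimately show ?thesis
    unfolding poly_extremal_weight by simp
qed

lemma coeff_extremal_cofactor:
  "coeff (extremal_cofactor a m) k = (if k \<le> m then poly (extremal_weight a m) (of_nat k) else 0)"
  by (simp add: extremal_cofactor_def coeff_sum)

lemma degree_extremal_cofactor_le: "degree (extremal_cofactor a m) \<le> m"
  by (rule degree_le) (simp add: coeff_extremal_cofactor)

text \<open>The zeros of the weight at \<open>-Suc a, \<dots>, -1\<close> and at \<open>m + 1, \<dots>, m + a\<close> turn the truncated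
  convolution into a full finite difference of order \<open>2 * Suc a\<close>, which exceeds the degree.\<close>

lemma coeff_linear_power_mult_extremal_cofactor:
  assumes "j \<le> m"
  shows "coeff ([:1, -1:] ^ (2 * Suc a) * extremal_cofactor a m) (j + Suc a) =
    (if j = m then - poly (extremal_weight a m) (of_nat (m + Suc a)) else 0)"
proof -
  define b where "b = Suc a"
  define q where "q = extremal_weight a m"
  define T where "T = (\<lambda>i. (-1) ^ i * of_nat (2 * b choose i) * poly q (of_nat (j + b) - of_nat i))"
  define X where "X = (\<lambda>i. coeff ([:1, -1:] ^ (2 * b)) i * coeff (extremal_cofactor a m) (j + b - i))"
  have coeff_pow: "coeff ([:1, -1:] ^ (2 * b)) i = (-1 :: complex) ^ i * of_nat (2 * b choose i)" for i
  proof (cases "i \<le> 2 * b")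
    case True
    then show ?thesis by (simp add: coeff_linear_poly_power)
  next
    case False
    then have "degree ([:1, -1 :: complex:] ^ (2 * b)) < i"
      by (simp add: degree_power_eq)
    with False show ?thesis by (simp add: coeff_eq_0 binomial_eq_0)
  qed
  \<comment> \<open>A convolution term \<open>X i\<close> equals the difference term
    \<open>T i\<close> except for \<open>i = 0\<close> and \<open>j = m\<close>: there the index is
    \<open>m + b\<close>, where the cofactor has coefficient 0 but the weight does not
    vanish.\<close>
  have step: "(if i \<le> j + b then X i else 0) = T i - (if i = 0 then (if j = m then T 0 else 0) else 0)"
    for i
  proof (cases "i \<le> j + b")
    case True
    have arg: "of_nat (j + b) - of_nat i = (of_nat (j + b - i) :: complex)"
      using True by (simp only: of_nat_diff)
    show ?thesis
    proof (cases "j + b - i \<le> m")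
      case True
      then have "\<not> (i = 0 \<and> j = m)" by (auto simp: b_def)
      with True \<open>i \<le> j + b\<close> show ?thesis
        unfolding X_def T_def arg coeff_pow coeff_extremal_cofactor q_def by auto
    next
      case False
      show ?thesis
      proof (cases "i = 0 \<and> j = m")
        case True
        with False show ?thesis
          unfolding X_def coeff_extremal_cofactor by simp
      next
        case nz: False
        have "poly q (of_nat (j + b - i)) = 0"
          unfolding q_def
          by (rule poly_extremal_weight_eq_0_right) (use False nz assms in \<open>auto simp: b_def\<close>)
        then have "T i = 0"
          unfolding T_def arg by simp
        with False nz show ?thesis
          unfolding X_def coeff_extremal_cofactor by auto
      qed
    qed
  next
    case False
    have "T i = 0"
    proof (cases "i \<le> 2 * b")
      case True
      have "of_nat (j + b) - of_nat i = (- of_nat (i - (j + b)) :: complex)"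
        using False by (simp add: of_nat_diff)
      moreover have "poly q (- of_nat (i - (j + b))) = 0"
        unfolding q_def by (rule poly_extremal_weight_eq_0_left) (use False True in \<open>auto simp: b_def\<close>)
      ultimately show ?thesis
        unfolding T_def by simp
    next
      case False
      then show ?thesis by (simp add: T_def binomial_eq_0)
    qed
    with False show ?thesis by auto
  qed
  have "(\<Sum>i\<le>2 * b. T i) = 0"
    unfolding T_def using degree_extremal_weight[of a m]
    by (intro backward_differences_poly_eq_0) (simp add: q_def b_def)
  \<comment> \<open>The range up to \<open>j + 3 * b\<close> contains both the range up to
    \<open>2 * b\<close> of the difference and the range up to \<open>j + b\<close> of the
    convolution.\<close>
  moreover have "(\<Sum>i\<le>2 * b. T i) = (\<Sum>i\<le>j + 3 * b. T i)"
    by (rule sum.mono_neutral_left) (auto simp: T_def binomial_eq_0)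
  moreover have "(\<Sum>i\<le>j + b. X i) = (\<Sum>i\<le>j + 3 * b. if i \<le> j + b then X i else 0)"
    by (rule sum.mono_neutral_cong_left) auto
  ultimately have "(\<Sum>i\<le>j + b. X i) = - (if j = m then T 0 else 0)"
    unfolding step by (simp add: sum_subtractf)
  moreover have "coeff ([:1, -1:] ^ (2 * b) * extremal_cofactor a m) (j + b) = (\<Sum>i\<le>j + b. X i)"
    by (simp add: coeff_mult X_def)
  ultimately show ?thesis
    by (simp add: b_def[symmetric] T_def q_def)
qed

text \<open>Adjointness moves \<open>(z - 1) ^ Suc a\<close> from \<open>h\<close> to the other
  side, where it raises the exponent to \<open>2 * Suc a\<close>. In the window of indices that
  remains, only the coefficient at the top survives, so the pairing sees just
  \<open>coeff h m\<close>.\<close>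

lemma sum_coeff_mult_extremal_poly:
  assumes "degree h \<le> m"
  shows "(\<Sum>k\<le>m + Suc a. coeff ([:-1, 1:] ^ Suc a * h) k * coeff (extremal_poly a m) k)
       = coeff h m * (fact (m + 2 * Suc a) / fact (m + Suc a) * fact a)"
    (is "?lhs = _ * ?\<kappa>")
proof -
  have "[:1, -1:] ^ Suc a * [:-1, 1:] ^ Suc a = smult ((-1) ^ Suc a) ([:1, -1::complex:] ^ (2 * Suc a))"
  proof -
    have "[:-1, 1:] = smult (-1) [:1, -1::complex:]" by simp
    then show ?thesis
      by (simp only: smult_power mult_smult_right power_add[symmetric] mult_2)
  qed
  then have "[:1, -1:] ^ Suc a * extremal_poly a m
      = smult ((-1) ^ Suc a) ([:1, -1:] ^ (2 * Suc a) * extremal_cofactor a m)"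
    unfolding extremal_poly_def mult.assoc[symmetric] by (simp only: mult_smult_left)
  \<comment> \<open>The signs \<open>(-1) ^ Suc a\<close> and \<open>(-1) ^ a\<close> and the minus
    sign of the lost term multiply to 1.\<close>
  then have cf: "coeff ([:1, -1:] ^ Suc a * extremal_poly a m) (k + Suc a) = (if k = m then ?\<kappa> else 0)"
    if "k \<le> m" for k
    by (simp only: coeff_smult coeff_linear_power_mult_extremal_cofactor[OF that] poly_extremal_weight_end)
       (simp add: power_mult_distrib[symmetric])
  have "?lhs = (\<Sum>k\<le>m. coeff h k * coeff ([:1, -1:] ^ Suc a * extremal_poly a m) (k + Suc a))"
    by (rule sum_coeff_mult_linear_power[OF assms])
  also have "\<dots> = (\<Sum>k\<le>m. coeff h k * (if k = m then ?\<kappa> else 0))"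
    by (intro sum.cong refl arg_cong2[where f = "(*)"] cf) auto
  also have "\<dots> = coeff h m * ?\<kappa>"
    by (simp add: if_distrib[of "(*) _"] del: fact_Suc cong: if_cong)
  finally show ?thesis .
qed

text \<open>Real coefficients make the bilinear pairing of \<open>extremal_poly a m\<close> with
  itself its squared \<open>L^2\<close> norm.\<close>

lemma coeff_extremal_poly_real: "coeff (extremal_poly a m) k \<in> \<real>"
proof -
  have mult: "\<forall>k. coeff (p * q) k \<in> \<real>" if "\<forall>k. coeff p k \<in> \<real>" "\<forall>k. coeff q k \<in> \<real>"
    for p q :: "complex poly"
    using that by (auto simp: coeff_mult intro!: sum_in_Reals)
  have "\<forall>k. coeff ([:-1, 1:] ^ n) k \<in> (\<real> :: complex set)" for n
    by (induction n) (auto simp: coeff_1 coeff_pCons split: nat.splits)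
  moreover have "\<forall>k. coeff (extremal_cofactor a m) k \<in> \<real>"
    by (auto simp: coeff_extremal_cofactor poly_extremal_weight intro!: prod_in_Reals Reals_mult simp del: prod.cl_ivl_Suc)
  ultimately show ?thesis
    unfolding extremal_poly_def using mult by blast
qed

lemma sum_norm_coeff_extremal_poly:
  "(\<Sum>k\<le>m + Suc a. (norm (coeff (extremal_poly a m) k))\<^sup>2)
     = (fact (m + Suc a) / fact m * fact a) * (fact (m + 2 * Suc a) / fact (m + Suc a) * fact a)"
proof -
  have sq: "of_real ((norm (coeff (extremal_poly a m) k))\<^sup>2)
      = coeff (extremal_poly a m) k * coeff (extremal_poly a m) k" for k
    using coeff_extremal_poly_real[of a m k]
    unfolding complex_norm_square by (simp add: Reals_cnj_iff)
  have "of_real (\<Sum>k\<le>m + Suc a. (norm (coeff (extremal_poly a m) k))\<^sup>2)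
      = (\<Sum>k\<le>m + Suc a. coeff (extremal_poly a m) k * coeff (extremal_poly a m) k)"
    by (simp only: of_real_sum sq)
  also have "\<dots> = coeff (extremal_cofactor a m) m * (fact (m + 2 * Suc a) / fact (m + Suc a) * fact a)"
    using sum_coeff_mult_extremal_poly[OF degree_extremal_cofactor_le[of a m], of a]
    by (simp only: extremal_poly_def[symmetric])
  also have "\<dots> = of_real ((fact (m + Suc a) / fact m * fact a) * (fact (m + 2 * Suc a) / fact (m + Suc a) * fact a))"
    by (simp add: coeff_extremal_cofactor poly_extremal_weight_m del: fact_Suc)
  finally show ?thesis
    by (simp only: of_real_eq_iff)
qed

section \<open>The \<open>L^2\<close> lower bound for a root of given order at 1\<close>

text \<open>Cauchy-Schwarz against the extremal polynomial \<open>G\<close>: since the cofactor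
  \<open>h\<close> is monic, \<open>g\<close> pairs with \<open>G\<close> to
  \<open>\<kappa>\<close>, while the squared norm of \<open>G\<close> is
  \<open>L * \<kappa>\<close>. This leaves \<open>\<kappa> / L\<close>, which is the ratio of
  factorials.\<close>

lemma sum_norm_coeff_sq_ge:
  fixes g :: "complex poly"
  assumes "lead_coeff g = 1" "[:-1, 1:] ^ b dvd g" "degree g = n"
  shows "fact (n + b) * fact (n - b) / (fact n)\<^sup>2 \<le> (\<Sum>k\<le>n. (norm (coeff g k))\<^sup>2)" and "b \<le> n"
proof -
  obtain h where g: "g = [:-1, 1:] ^ b * h"
    using assms(2) by (auto elim: dvdE)
  have "h \<noteq> 0"
    using assms(1) g by auto
  then have deg: "n = degree h + b"
    using assms(3) by (simp add: g degree_mult_eq degree_power_eq del: power_Suc)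
  then show "b \<le> n" by simp
  have lead: "lead_coeff h = 1"
    using assms(1) by (simp add: g lead_coeff_mult lead_coeff_power)
  show "fact (n + b) * fact (n - b) / (fact n)\<^sup>2 \<le> (\<Sum>k\<le>n. (norm (coeff g k))\<^sup>2)"
  proof (cases b)
    \<comment> \<open>The extremal polynomials have order at least 1 at the point 1, so here the
      leading coefficient alone gives the bound.\<close>
    case 0
    have "1 = (norm (coeff g n))\<^sup>2"
      using assms by simp
    also have "\<dots> \<le> (\<Sum>k\<le>n. (norm (coeff g k))\<^sup>2)"
      by (rule member_le_sum) auto
    finally show ?thesis
      using 0 by (simp add: power2_eq_square)
  next
    case (Suc a)
    define m where "m = degree h"
    define G where "G = extremal_poly a m"
    define \<kappa> :: real where "\<kappa> = fact (m + 2 * Suc a) / fact (m + Suc a) * fact a"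
    define L :: real where "L = fact (m + Suc a) / fact m * fact a"
    have pos: "\<kappa> > 0" "L > 0" by (auto simp: \<kappa>_def L_def)
    have n: "n = m + Suc a" using deg Suc by (simp add: m_def)
    have "(\<Sum>k\<le>n. coeff g k * coeff G k) = of_real \<kappa>"
      using sum_coeff_mult_extremal_poly[of h m a] lead Suc
      unfolding g G_def n \<kappa>_def by (simp add: m_def del: power_Suc fact_Suc)
    then have "\<kappa> = norm (\<Sum>k\<le>n. coeff g k * coeff G k)"
      using pos by simp
    also have "\<dots> \<le> (\<Sum>k\<le>n. norm (coeff g k) * norm (coeff G k))"
      by (rule order_trans[OF norm_sum]) (simp add: norm_mult)
    finally have "\<kappa>\<^sup>2 \<le> (\<Sum>k\<le>n. norm (coeff g k) * norm (coeff G k))\<^sup>2"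
      using pos by (intro power_mono) auto
    also have "\<dots> \<le> (\<Sum>k\<le>n. (norm (coeff g k))\<^sup>2) * (\<Sum>k\<le>n. (norm (coeff G k))\<^sup>2)"
      by (rule Cauchy_Schwarz_ineq_sum)
    also have "(\<Sum>k\<le>n. (norm (coeff G k))\<^sup>2) = L * \<kappa>"
      unfolding n G_def L_def \<kappa>_def by (rule sum_norm_coeff_extremal_poly)
    finally have "\<kappa> / L \<le> (\<Sum>k\<le>n. (norm (coeff g k))\<^sup>2)"
      using pos by (simp add: power2_eq_square field_simps)
    moreover have "\<kappa> / L = fact (n + b) * fact (n - b) / (fact n)\<^sup>2"
      unfolding \<kappa>_def L_def n Suc by (simp add: power2_eq_square mult_2 add_ac del: fact_Suc)
    ultimately show ?thesis by simp
  qed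
qed

section \<open>Exponential bounds for the ratio of factorials\<close>

text \<open>The difference of the two sides vanishes at 0 and has derivative
  \<open>2 * x^2 / (1 - x^2)\<close>.\<close>

lemma two_mult_le_ln_ratio:
  fixes y :: real
  assumes "0 \<le> y" "y < 1"
  shows "2 * y \<le> ln ((1 + y) / (1 - y))"
proof -
  define F where "F = (\<lambda>y::real. ln (1 + y) - ln (1 - y) - 2 * y)"
  have "F 0 \<le> F y"
  proof (rule DERIV_nonneg_imp_nondecreasing[OF assms(1)])
    fix x assume x: "0 \<le> x" "x \<le> y"
    then have "(F has_real_derivative (1 / (1 + x) + 1 / (1 - x) - 2)) (at x)"
      using assms unfolding F_def by (auto intro!: derivative_eq_intros)
    moreover have "1 / (1 + x) + 1 / (1 - x) - 2 = 2 * x\<^sup>2 / ((1 + x) * (1 - x))"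
      using x assms by (simp add: divide_simps) (simp add: power2_eq_square algebra_simps)
    moreover have "2 * x\<^sup>2 / ((1 + x) * (1 - x)) \<ge> 0"
      using x assms by (intro divide_nonneg_nonneg mult_nonneg_nonneg) auto
    ultimately show "\<exists>d. (F has_real_derivative d) (at x) \<and> 0 \<le> d"
      by metis
  qed
  then show ?thesis
    using assms by (simp add: F_def ln_div)
qed

lemma fact_ratio_Suc:
  assumes "Suc b \<le> n"
  shows "fact (n + Suc b) * fact (n - Suc b) / (fact n)\<^sup>2
     = fact (n + b) * fact (n - b) / (fact n)\<^sup>2 * ((real n + real b + 1) / (real n - real b))"
proof -
  have "n - b = Suc (n - Suc b)"
    using assms by simp
  then have "fact (n - b) = (real n - real b) * fact (n - Suc b)"
    using assms by (simp add: of_nat_diff algebra_simps)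
  moreover have "real n - real b \<noteq> 0"
    using assms by simp
  ultimately show ?thesis
    by (simp add: add_ac)
qed

text \<open>Passing from \<open>b\<close> to \<open>Suc b\<close> multiplies the ratio by
  \<open>(1 + y) / (1 - y)\<close> with \<open>y = (2b + 1) / (2n + 1)\<close>, hence by at least
  \<open>exp (2 * y)\<close>. The odd numbers \<open>2b + 1\<close> add up to a square.\<close>

lemma exp_le_fact_ratio:
  assumes "b \<le> n"
  shows "exp (2 * (real b)\<^sup>2 / (2 * real n + 1)) \<le> fact (n + b) * fact (n - b) / (fact n)\<^sup>2"
  using assms
proof (induction b)
  case 0
  then show ?case by (simp add: power2_eq_square)
next
  case (Suc b)
  define y where "y = (2 * real b + 1) / (2 * real n + 1)"
  have b: "real b + 1 \<le> real n"
    using Suc.prems by linarith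
  have "(1 + y) / (1 - y) = (real n + real b + 1) / (real n - real b)"
  proof -
    have "1 + y = 2 * (real n + real b + 1) / (2 * real n + 1)"
         "1 - y = 2 * (real n - real b) / (2 * real n + 1)"
      unfolding y_def by (simp_all add: field_simps)
    moreover have "(2 * p / d) / (2 * q / d) = p / q" if "d \<noteq> 0" for p q d :: real
      using that by simp
    ultimately show ?thesis by (simp only:)
  qed
  moreover have "2 * y \<le> ln ((1 + y) / (1 - y))"
    using b by (intro two_mult_le_ln_ratio) (auto simp: y_def)
  ultimately have "exp (2 * y) \<le> (real n + real b + 1) / (real n - real b)"
    using b by (metis add_pos_nonneg divide_pos_pos exp_le_cancel_iff exp_ln diff_gt_0_iff_gt
        less_add_one add.commute of_nat_0_le_iff order_less_le_trans zero_less_one add_nonneg_pos add_nonneg_nonneg)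
  moreover have "2 * (real (Suc b))\<^sup>2 / (2 * real n + 1) = 2 * (real b)\<^sup>2 / (2 * real n + 1) + 2 * y"
    unfolding y_def times_divide_eq_right add_divide_distrib[symmetric]
    by (simp add: power2_eq_square algebra_simps)
  ultimately show ?case
    unfolding fact_ratio_Suc[OF Suc.prems] using Suc
    by (simp only: exp_add) (intro mult_mono, auto)
qed

text \<open>Each factor is \<open>1 + (2j + 1) / (n - j)\<close>, at most
  \<open>exp ((2j + 1) / (n - b))\<close>. Keeping the denominator at \<open>n - b\<close>
  throughout the induction lets the odd numbers telescope to \<open>b^2\<close>.\<close>

lemma fact_ratio_le_exp:
  assumes "b < n"
  shows "fact (n + b) * fact (n - b) / (fact n)\<^sup>2 \<le> exp ((real b)\<^sup>2 / (real n - real b))"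
proof -
  have "fact (n + j) * fact (n - j) / (fact n)\<^sup>2 \<le> exp ((real j)\<^sup>2 / (real n - real b))" if "j \<le> b" for j
    using that
  proof (induction j)
    case 0
    then show ?case by (simp add: power2_eq_square)
  next
    case (Suc j)
    have "(real n + real j + 1) / (real n - real j) = 1 + (2 * real j + 1) / (real n - real j)"
      using Suc.prems assms by (simp add: field_simps)
    also have "\<dots> \<le> exp ((2 * real j + 1) / (real n - real j))"
      by (rule exp_ge_add_one_self)
    also have "\<dots> \<le> exp ((2 * real j + 1) / (real n - real b))"
      using Suc.prems assms by (auto intro!: divide_left_mono)
    finally have "(real n + real j + 1) / (real n - real j) \<le> exp ((2 * real j + 1) / (real n - real b))" .
    moreover have "(real (Suc j))\<^sup>2 / (real n - real b)
        = (real j)\<^sup>2 / (real n - real b) + (2 * real j + 1) / (real n - real b)"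
      unfolding add_divide_distrib[symmetric] by (simp add: power2_eq_square algebra_simps)
    moreover have "Suc j \<le> n" using Suc.prems assms by simp
    ultimately show ?case
      using Suc by (simp only: fact_ratio_Suc exp_add) (intro mult_mono, auto)
  qed
  then show ?thesis by simp
qed

section \<open>Radial projection of the roots\<close>

lemma lead_coeff_prod_mset_linear:
  fixes c :: "'b \<Rightarrow> 'a::idom"
  shows "lead_coeff (\<Prod>x\<in>#A. [:c x, 1:]) = 1"
proof (induction A)
  case (add x A)
  show ?case
    unfolding image_mset_add_mset prod_mset.add_mset lead_coeff_mult add.IH by simp
qed simp

lemma degree_prod_mset_linear:
  fixes c :: "'b \<Rightarrow> 'a::idom"
  shows "degree (\<Prod>x\<in>#A. [:c x, 1:]) = size A"
proof (induction A)
  case (add x A)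
  have "(\<Prod>x\<in>#A. [:c x, 1:]) \<noteq> 0" by force
  with add show ?case
    by (simp add: degree_mult_eq del: mult_pCons_left)
qed simp

text \<open>For \<open>x \<noteq> 0\<close> the squares of the two sides differ by exactly
  \<open>(norm x - 1)^2\<close>.\<close>

lemma sqrt_norm_mult_norm_diff_sgn_le:
  fixes z x :: complex
  assumes "norm z = 1"
  shows "sqrt (norm x) * norm (z - sgn x) \<le> norm (z - x)"
proof -
  define r where "r = norm x"
  have x: "x = of_real r * sgn x"
    by (simp add: r_def sgn_eq)
  have sq: "(norm (z - of_real t * s))\<^sup>2 = 1 - 2 * t * Re (z * cnj s) + t\<^sup>2 * (norm s)\<^sup>2" for t s
  proof -
    have "(norm (z - of_real t * s))\<^sup>2 = (norm z)\<^sup>2 - 2 * t * Re (z * cnj s) + t\<^sup>2 * (norm s)\<^sup>2"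
      unfolding cmod_power2 by (simp add: power2_eq_square algebra_simps)
    then show ?thesis using assms by simp
  qed
  show ?thesis
  proof (cases "x = 0")
    case False
    then have s: "norm (sgn x) = 1" by (simp add: norm_sgn)
    have "(sqrt r * norm (z - sgn x))\<^sup>2 = r * (2 - 2 * Re (z * cnj (sgn x)))"
      using sq[of 1 "sgn x"] s by (simp add: power_mult_distrib r_def)
    also have "\<dots> \<le> 1 - 2 * r * Re (z * cnj (sgn x)) + r\<^sup>2"
      using zero_le_power2[of "r - 1"] by (simp add: power2_eq_square algebra_simps)
    also have "\<dots> = (norm (z - x))\<^sup>2"
      using sq[of r "sgn x"] s x by simp
    finally show ?thesis
      unfolding r_def by (rule power2_le_imp_le) simp
  qed simp
qed

text \<open>Dividing by \<open>u\<close> is the rotation that brings a chosen ray to the positive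
  axis; it does not change the moduli.\<close>

lemma sqrt_prod_mset_norm_le:
  fixes z u :: complex
  assumes "norm z = 1" "norm u = 1"
  shows "sqrt (\<Prod>x\<in>#A. norm x) * norm (\<Prod>x\<in>#A. z / u - sgn x / u) \<le> norm (\<Prod>x\<in>#A. z - x)"
proof (induction A)
  case (add x A)
  have "norm (z / u - sgn x / u) = norm (z - sgn x)"
    using assms by (simp add: diff_divide_distrib[symmetric] norm_divide)
  then have "sqrt (norm x) * norm (z / u - sgn x / u) \<le> norm (z - x)"
    using sqrt_norm_mult_norm_diff_sgn_le[OF assms(1), of x] by simp
  moreover have "0 \<le> (\<Prod>x\<in>#A. norm x)"
    by (induction A) auto
  ultimately show ?case
    using mult_mono[OF _ add, of "sqrt (norm x) * norm (z / u - sgn x / u)" "norm (z - x)"]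
    by (simp add: real_sqrt_mult norm_mult mult_ac)
qed simp

lemma bdd_above_norm_poly_sphere: "bdd_above ((\<lambda>z. norm (poly f z)) ` sphere 0 1)" for f :: "complex poly"
  by (intro bounded_imp_bdd_above compact_imp_bounded compact_continuous_image continuous_intros compact_sphere)

lemma N_theta_eq_size:
  assumes "f \<noteq> 0"
  shows "N_theta \<theta> f = size (filter_mset (\<lambda>z. \<exists>r>0. z = complex_of_real r * cis (2 * pi * \<theta>)) (proots f))"
  unfolding N_theta_def size_multiset_overloaded_eq using assms
  by (intro sum.cong) auto

lemma N_pos_eq_N_theta: "N_pos f = N_theta 0 f"
  unfolding N_pos_def N_theta_def
  by (intro sum.cong) (auto simp: complex_is_Real_iff complex_eq_iff)

lemma N_neg_eq_N_theta: "N_neg f = N_theta (1/2) f"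
proof -
  have "z \<in> \<real> \<and> Re z < 0 \<longleftrightarrow> (\<exists>r>0. z = complex_of_real r * cis (2 * pi * (1/2)))" for z
  proof
    assume "z \<in> \<real> \<and> Re z < 0"
    then show "\<exists>r>0. z = complex_of_real r * cis (2 * pi * (1/2))"
      by (intro exI[of _ "- Re z"]) (auto simp: complex_is_Real_iff complex_eq_iff)
  qed auto
  then show ?thesis
    unfolding N_neg_def N_theta_def by simp
qed

section \<open>The upper bound for the number of roots on a ray\<close>

text \<open>The lower and upper bounds for the \<open>L^2\<close> norm are compared for
  \<open>g ^ k\<close>, which has degree \<open>k * n\<close>, a root of order at least
  \<open>k * b\<close> at 1, and the bound \<open>M ^ k\<close> on the circle.\<close>

lemma root_multiplicity_sq_le:
  fixes g :: "complex poly"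
  assumes g: "lead_coeff g = 1" "[:-1, 1:] ^ b dvd g" "degree g \<ge> 1"
    and M: "\<And>z. norm z = 1 \<Longrightarrow> norm (poly g z) \<le> M"
  shows "M \<ge> 1" and "(real b)\<^sup>2 \<le> 2 * real (degree g) * ln M"
proof -
  define n where "n = degree g"
  have n: "n \<ge> 1" using g by (simp add: n_def)
  have M0: "M \<ge> 0"
    using M[of 1] norm_ge_zero order_trans by (metis norm_one)
  have key: "exp (2 * (real (k * b))\<^sup>2 / (2 * real (k * n) + 1)) \<le> (M ^ k)\<^sup>2" for k
  proof -
    have lead: "lead_coeff (g ^ k) = 1"
      using g(1) by (simp add: lead_coeff_power)
    have dvd: "[:-1, 1:] ^ (k * b) dvd g ^ k"
      using dvd_power_same[OF g(2), of k] by (simp add: power_mult[symmetric] mult.commute)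
    have deg: "degree (g ^ k) = k * n"
      using g by (subst degree_power_eq) (auto simp: n_def)
    have "exp (2 * (real (k * b))\<^sup>2 / (2 * real (k * n) + 1))
        \<le> fact (k * n + k * b) * fact (k * n - k * b) / (fact (k * n))\<^sup>2"
      by (rule exp_le_fact_ratio[OF sum_norm_coeff_sq_ge(2)[OF lead dvd deg]])
    also have "\<dots> \<le> (\<Sum>i\<le>k * n. (norm (coeff (g ^ k) i))\<^sup>2)"
      by (rule sum_norm_coeff_sq_ge(1)[OF lead dvd deg])
    also have "\<dots> \<le> (M ^ k)\<^sup>2"
      using M by (intro sum_norm_coeff_sq_le) (auto simp: deg norm_power intro!: power_mono)
    finally show ?thesis .
  qed
  have "1\<^sup>2 \<le> exp (2 * (real b)\<^sup>2 / (2 * real n + 1))"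
    by simp
  also have "\<dots> \<le> M\<^sup>2"
    using key[of 1] by simp
  finally have "1\<^sup>2 \<le> M\<^sup>2" .
  then show M1: "M \<ge> 1"
    using M0 power2_le_imp_le by blast
  \<comment> \<open>At \<open>k = 1\<close> this misses the claim by a factor \<open>2n / (2n + 1)\<close>, which passing to powers of \<open>g\<close> removes.\<close>
  have "real k * (real b)\<^sup>2 / (2 * real k * real n + 1) \<le> ln M" if "k > 0" for k
  proof -
    have "2 * (real (k * b))\<^sup>2 / (2 * real (k * n) + 1) \<le> ln ((M ^ k)\<^sup>2)"
      using key[of k] M1 by (subst ln_ge_iff) auto
    also have "\<dots> = 2 * real k * ln M"
      using M1 by (simp add: ln_realpow)
    finally have "real k * (2 * (real k * (real b)\<^sup>2 / (2 * real k * real n + 1))) \<le> real k * (2 * ln M)"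
      by (simp add: power2_eq_square mult_ac)
    then show ?thesis
      using that by (simp only: mult_le_cancel_left_pos of_nat_0_less_iff)
  qed
  moreover have "(\<lambda>k. real k * (real b)\<^sup>2 / (2 * real k * real n + 1)) \<longlonglongrightarrow> (real b)\<^sup>2 / (2 * real n)"
  proof -
    have "real n > 0" using n by simp
    then have "(\<lambda>k. real k * (real b)\<^sup>2 / (2 * real k * real n + 1)) \<longlonglongrightarrow> (real b)\<^sup>2 * inverse (real n) / 2"
      by real_asymp
    then show ?thesis by (simp add: field_simps)
  qed
  ultimately have "(real b)\<^sup>2 / (2 * real n) \<le> ln M"
    by (intro LIMSEQ_le_const2) (auto intro!: exI[of _ 1])
  then show "(real b)\<^sup>2 \<le> 2 * real (degree g) * ln M"
    using n by (simp add: field_simps n_def)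
qed

text \<open>The polynomial \<open>g\<close> has the roots \<open>sgn x / u\<close>, so every root of
  \<open>f\<close> on the ray becomes a root at 1. The first claim makes the logarithm in the height
  nonnegative.\<close>

lemma N_theta_sq_le:
  assumes "degree f \<ge> 1" "poly f 0 \<noteq> 0"
  shows "(SUP z\<in>sphere 0 1. cmod (poly f z)) / sqrt (cmod (coeff f 0) * cmod (lead_coeff f)) \<ge> 1"
    and "(real (N_theta \<theta> f))\<^sup>2 \<le> 2 * poly_height f * (real (degree f))\<^sup>2"
proof -
  define M where "M = (SUP z\<in>sphere 0 1. cmod (poly f z)) / sqrt (cmod (coeff f 0) * cmod (lead_coeff f))"
  define u where "u = cis (2 * pi * \<theta>)"
  define A where "A = proots f"
  define ray where "ray = (\<lambda>z. \<exists>r>0. z = complex_of_real r * u)"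
  define g where "g = (\<Prod>x\<in>#A. [:- (sgn x / u), 1:])"
  have f0: "f \<noteq> 0" using assms by auto
  have u: "norm u = 1" "u \<noteq> 0" by (auto simp: u_def)
  have f: "f = smult (lead_coeff f) (\<Prod>x\<in>#A. [:-x, 1:])"
    unfolding A_def by (simp add: complex_poly_decompose_multiset)
  have poly_f: "poly f z = lead_coeff f * (\<Prod>x\<in>#A. z - x)" for z
    by (subst f) (simp add: poly_prod_mset)
  have size: "size A = degree f"
    by (simp add: A_def size_proots_complex)
  have lead: "lead_coeff g = 1"
    unfolding g_def by (rule lead_coeff_prod_mset_linear)
  have deg: "degree g = degree f"
    by (simp add: g_def degree_prod_mset_linear size)
  have N: "N_theta \<theta> f = size (filter_mset ray A)"
    using N_theta_eq_size[OF f0] by (simp add: A_def ray_def u_def)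
  have "(\<Prod>x\<in>#filter_mset ray A. [:- (sgn x / u), 1:]) = (\<Prod>x\<in>#filter_mset ray A. [:-1, 1:])"
  proof (intro arg_cong[where f = prod_mset] image_mset_cong)
    fix x assume "x \<in># filter_mset ray A"
    then obtain r where "r > 0" "x = complex_of_real r * u"
      by (auto simp: ray_def)
    then have "sgn x / u = 1"
      using u by (simp add: sgn_eq norm_mult)
    then show "[:- (sgn x / u), 1:] = [:-1, 1:]" by simp
  qed
  then have "(\<Prod>x\<in>#filter_mset ray A. [:- (sgn x / u), 1:]) = [:-1, 1:] ^ N_theta \<theta> f"
    by (simp add: N)
  moreover have "g = (\<Prod>x\<in>#filter_mset ray A. [:- (sgn x / u), 1:]) *
      (\<Prod>x\<in>#filter_mset (\<lambda>x. \<not> ray x) A. [:- (sgn x / u), 1:])"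
    unfolding g_def by (subst multiset_partition[of A ray]) (simp only: image_mset_union prod_mset_Un)
  ultimately have dvd: "[:-1, 1:] ^ N_theta \<theta> f dvd g"
    by simp
  have a0: "cmod (coeff f 0) = cmod (lead_coeff f) * (\<Prod>x\<in>#A. norm x)"
  proof -
    have "norm (\<Prod>x\<in>#A. 0 - x) = (\<Prod>x\<in>#A. norm x)"
      by (induction A) (auto simp: norm_mult)
    then show ?thesis
      using poly_f[of 0] by (simp add: poly_0_coeff_0 norm_mult)
  qed
  \<comment> \<open>By Vieta, the normalisation in the height is the leading coefficient times
    exactly the factor lost in the radial projection.\<close>
  have sq: "sqrt (cmod (coeff f 0) * cmod (lead_coeff f)) = cmod (lead_coeff f) * sqrt (\<Prod>x\<in>#A. norm x)"
    unfolding a0 by (simp add: real_sqrt_mult mult_ac)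
  have sqpos: "sqrt (cmod (coeff f 0) * cmod (lead_coeff f)) > 0"
    using assms f0 by (simp add: poly_0_coeff_0)
  have bound: "norm (poly g w) \<le> M" if w: "norm w = 1" for w
  proof -
    \<comment> \<open>Undoing the rotation, the value of \<open>g\<close> at \<open>w\<close> is
      compared with that of \<open>f\<close> at \<open>w * u\<close>.\<close>
    have z: "norm (w * u) = 1" using w u by (simp add: norm_mult)
    have "poly g w = (\<Prod>x\<in>#A. w * u / u - sgn x / u)"
      using u by (simp add: g_def poly_prod_mset)
    then have "sqrt (\<Prod>x\<in>#A. norm x) * norm (poly g w) \<le> norm (\<Prod>x\<in>#A. w * u - x)"
      using sqrt_prod_mset_norm_le[OF z u(1), of A] by simp
    then have "cmod (lead_coeff f) * (sqrt (\<Prod>x\<in>#A. norm x) * norm (poly g w))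
        \<le> cmod (lead_coeff f) * norm (\<Prod>x\<in>#A. w * u - x)"
      by (rule mult_left_mono) simp
    then have "sqrt (cmod (coeff f 0) * cmod (lead_coeff f)) * norm (poly g w) \<le> norm (poly f (w * u))"
      unfolding sq poly_f[of "w * u"] by (simp add: norm_mult mult.assoc)
    also have "\<dots> \<le> (SUP z\<in>sphere 0 1. cmod (poly f z))"
      using z by (intro cSUP_upper bdd_above_norm_poly_sphere) auto
    finally show ?thesis
      unfolding M_def using sqpos by (simp add: pos_le_divide_eq mult.commute)
  qed
  have deg1: "degree g \<ge> 1" using deg assms by simp
  show "(SUP z\<in>sphere 0 1. cmod (poly f z)) / sqrt (cmod (coeff f 0) * cmod (lead_coeff f)) \<ge> 1"
    using root_multiplicity_sq_le(1)[OF lead dvd deg1 bound] by (simp add: M_def)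
  have "(real (N_theta \<theta> f))\<^sup>2 \<le> 2 * real (degree f) * ln M"
    using root_multiplicity_sq_le(2)[OF lead dvd deg1 bound] by (simp add: deg)
  also have "ln M = poly_height f * real (degree f)"
    using assms by (simp add: poly_height_def M_def)
  finally show "(real (N_theta \<theta> f))\<^sup>2 \<le> 2 * poly_height f * (real (degree f))\<^sup>2"
    by (simp add: power2_eq_square mult_ac)
qed

lemma poly_height_nonneg:
  assumes "degree f \<ge> 1" "poly f 0 \<noteq> 0"
  shows "poly_height f \<ge> 0"
  unfolding poly_height_def using N_theta_sq_le(1)[OF assms] by simp

lemma N_theta_le:
  assumes "degree f \<ge> 1" "poly f 0 \<noteq> 0"
  shows "real (N_theta \<theta> f) \<le> sqrt 2 * sqrt (poly_height f) * real (degree f)"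
  using real_le_rsqrt[OF N_theta_sq_le(2)[OF assms, of \<theta>]] by (simp add: real_sqrt_mult)

section \<open>Sharpness of the constant\<close>

lemma pcompose_power: "(p ^ n) \<circ>\<^sub>p q = (p \<circ>\<^sub>p q) ^ n" for p q :: "'a::comm_ring_1 poly"
  by (induction n) (simp_all add: pcompose_mult pcompose_1)

text \<open>Substituting \<open>z / u\<close> for \<open>z\<close> moves the root 1 to
  \<open>u\<close> and preserves the maximum on the circle and the moduli of the end coefficients.
  One family of polynomials with roots at 1 thus serves every \<open>\<theta>\<close>.\<close>

lemma rotate_root_at_1:
  fixes g :: "complex poly"
  assumes "g \<noteq> 0" "[:-1, 1:] ^ b dvd g"
  obtains f where "degree f = degree g" "poly f 0 = poly g 0" "poly_height f = poly_height g"
    "b \<le> N_theta \<theta> f"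
proof
  define u where "u = cis (2 * pi * \<theta>)"
  define f where "f = g \<circ>\<^sub>p [:0, 1 / u:]"
  have u: "norm u = 1" "u \<noteq> 0" by (auto simp: u_def)
  show deg: "degree f = degree g"
    using u by (simp add: f_def degree_pcompose)
  show p0: "poly f 0 = poly g 0"
    by (simp add: f_def poly_pcompose)
  have f0: "f \<noteq> 0"
    using assms(1) u by (simp add: f_def pcompose_eq_0_iff)
  have lead: "cmod (lead_coeff f) = cmod (lead_coeff g)"
    using u lead_coeff_comp[of "[:0, 1 / u:]" g]
    by (simp add: f_def norm_mult norm_power norm_divide)
  have "(\<lambda>z. z / u) ` sphere 0 1 = sphere 0 1"
  proof (intro equalityI subsetI)
    fix z :: complex assume "z \<in> sphere 0 1"
    then show "z \<in> (\<lambda>z. z / u) ` sphere 0 1"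
      using u by (intro image_eqI[of _ _ "z * u"]) (auto simp: norm_mult)
  qed (use u in \<open>auto simp: norm_divide\<close>)
  then have "(\<lambda>z. cmod (poly g z)) ` sphere 0 1 = (\<lambda>z. cmod (poly g z)) ` (\<lambda>z. z / u) ` sphere 0 1"
    by simp
  also have "\<dots> = (\<lambda>z. cmod (poly f z)) ` sphere 0 1"
    by (simp add: image_image f_def poly_pcompose)
  finally show "poly_height f = poly_height g"
    using lead p0 by (simp add: poly_height_def deg poly_0_coeff_0)
  obtain h where "g = [:-1, 1:] ^ b * h"
    using assms(2) by (auto elim: dvdE)
  then have "f = ([:-1, 1:] \<circ>\<^sub>p [:0, 1 / u:]) ^ b * (h \<circ>\<^sub>p [:0, 1 / u:])"
    by (simp only: f_def pcompose_mult pcompose_power)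
  also have "[:-1, 1:] \<circ>\<^sub>p [:0, 1 / u:] = smult (1 / u) [:- u, 1:]"
    using u by (simp add: pcompose_pCons)
  finally have "f = smult (1 / u) [:- u, 1:] ^ b * (h \<circ>\<^sub>p [:0, 1 / u:])" .
  then have "[:- u, 1:] ^ b dvd f"
    unfolding smult_power mult_smult_left by (metis dvd_smult dvd_triv_left)
  then have "b \<le> order u f"
    using f0 by (simp add: order_divides)
  \<comment> \<open>The point \<open>u\<close> lies on the ray with \<open>r = 1\<close>, so its
    order is one summand of the count.\<close>
  also have "\<dots> \<le> N_theta \<theta> f"
  proof (cases "poly f u = 0")
    case True
    have "finite {z. poly f z = 0}" by (rule poly_roots_finite[OF f0])
    moreover have "\<exists>r>0. u = complex_of_real r * cis (2 * pi * \<theta>)"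
      by (rule exI[of _ 1]) (simp add: u_def)
    ultimately show ?thesis
      unfolding N_theta_def using True by (intro member_le_sum) auto
  next
    case False
    then show ?thesis by (simp add: order_0I)
  qed
  finally show "b \<le> N_theta \<theta> f" .
qed

lemma degree_extremal_poly: "degree (extremal_poly a m) = m + Suc a"
  and lead_coeff_extremal_poly: "lead_coeff (extremal_poly a m) = fact (m + Suc a) / fact m * fact a"
proof -
  have ne: "coeff (extremal_cofactor a m) m \<noteq> 0"
    by (simp add: coeff_extremal_cofactor poly_extremal_weight_m del: fact_Suc)
  then have deg: "degree (extremal_cofactor a m) = m"
    using degree_extremal_cofactor_le[of a m] le_degree[OF ne] by simp
  have "extremal_cofactor a m \<noteq> 0" using ne by auto
  then show "degree (extremal_poly a m) = m + Suc a"
    unfolding extremal_poly_def by (simp add: degree_mult_eq degree_power_eq deg del: power_Suc)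
  have "lead_coeff (extremal_cofactor a m) = fact (m + Suc a) / fact m * fact a"
    unfolding deg by (simp add: coeff_extremal_cofactor poly_extremal_weight_m del: fact_Suc)
  then show "lead_coeff (extremal_poly a m) = fact (m + Suc a) / fact m * fact a"
    unfolding extremal_poly_def lead_coeff_mult lead_coeff_power by simp
qed

lemma norm_coeff_0_extremal_poly:
  "norm (coeff (extremal_poly a m) 0) = fact (Suc a) * (fact (m + a) / fact m)"
proof -
  have "coeff (extremal_poly a m) 0 = (-1) ^ Suc a * coeff (extremal_cofactor a m) 0"
    unfolding extremal_poly_def poly_0_coeff_0[symmetric] by simp
  then show ?thesis
    by (simp add: coeff_extremal_cofactor poly_extremal_weight_0 norm_mult norm_divide norm_power del: fact_Suc power_Suc)
qed

lemma poly_extremal_poly_0_neq_0: "poly (extremal_poly a m) 0 \<noteq> 0"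
  using norm_coeff_0_extremal_poly[of a m] by (auto simp: poly_0_coeff_0)

text \<open>Cauchy-Schwarz on the coefficients bounds the maximum by \<open>sqrt (n + 1)\<close>
  times the \<open>L^2\<close> norm. After normalisation the squared norm is
  \<open>\<kappa> / q = (n / Suc a) * P\<close>, and \<open>P\<close> is bounded by
  \<open>fact_ratio_le_exp\<close> with \<open>n - Suc a = m\<close>.\<close>

lemma poly_height_extremal_poly_le:
  fixes a m :: nat
  assumes "m > 0"
  defines "n \<equiv> m + Suc a"
  shows "poly_height (extremal_poly a m) * real n
     \<le> (ln (real n + 1) + ln (real n / real (Suc a)) + (real (Suc a))\<^sup>2 / real m) / 2"
proof -
  define G where "G = extremal_poly a m"
  define S where "S = (SUP z\<in>sphere 0 1. cmod (poly G z))"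
  define \<kappa> :: real where "\<kappa> = fact (m + 2 * Suc a) / fact (m + Suc a) * fact a"
  define L :: real where "L = fact (m + Suc a) / fact m * fact a"
  define q :: real where "q = fact (Suc a) * (fact (m + a) / fact m)"
  define P :: real where "P = fact (n + Suc a) * fact (n - Suc a) / (fact n)\<^sup>2"
  have pos: "\<kappa> > 0" "L > 0" "q > 0" "P > 0" "n > 0"
    by (auto simp: \<kappa>_def L_def q_def P_def n_def)
  have L: "cmod (lead_coeff G) = L"
    unfolding G_def lead_coeff_extremal_poly L_def
    by (simp add: norm_mult norm_divide del: fact_Suc)
  have q: "cmod (coeff G 0) = q"
    by (simp add: G_def q_def norm_coeff_0_extremal_poly del: fact_Suc)
  have deg: "degree G = n"
    by (simp add: G_def n_def degree_extremal_poly)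
  have "S \<le> sqrt ((real n + 1) * (L * \<kappa>))"
    unfolding S_def
  proof (rule cSUP_least)
    fix z :: complex assume "z \<in> sphere 0 1"
    then have z: "norm z = 1" by simp
    have "norm (poly G z) \<le> (\<Sum>k\<le>n. 1 * norm (coeff G k))"
      unfolding poly_altdef deg by (rule order_trans[OF norm_sum]) (simp add: norm_mult norm_power z)
    then have "(norm (poly G z))\<^sup>2 \<le> (\<Sum>k\<le>n. 1 * norm (coeff G k))\<^sup>2"
      by (rule power_mono) simp
    also have "\<dots> \<le> (\<Sum>k\<le>n. 1\<^sup>2) * (\<Sum>k\<le>n. (norm (coeff G k))\<^sup>2)"
      by (rule Cauchy_Schwarz_ineq_sum)
    also have "\<dots> = (real n + 1) * (L * \<kappa>)"
      unfolding n_def G_def L_def \<kappa>_def sum_norm_coeff_extremal_poly by simp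
    finally show "cmod (poly G z) \<le> sqrt ((real n + 1) * (L * \<kappa>))"
      by (rule real_le_rsqrt)
  qed simp
  then have "S / sqrt (q * L) \<le> sqrt ((real n + 1) * (L * \<kappa>)) / sqrt (q * L)"
    using pos by (intro divide_right_mono) auto
  also have "\<dots> = sqrt ((real n + 1) * (\<kappa> / q))"
    using pos by (simp add: real_sqrt_divide[symmetric])
  also have "\<kappa> / q = real n / real (Suc a) * P"
  proof -
    have "q * real n = L * real (Suc a)"
      unfolding q_def L_def n_def by (simp add: field_simps)
    moreover have "\<kappa> = P * L"
      unfolding \<kappa>_def P_def L_def n_def by (simp add: power2_eq_square mult_2 add_ac del: fact_Suc)
    ultimately show ?thesis
      using pos by (simp add: field_simps)
  qed
  finally have le: "S / sqrt (q * L) \<le> sqrt ((real n + 1) * (real n / real (Suc a) * P))" .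
  have "S / sqrt (q * L) \<ge> 1"
    using N_theta_sq_le(1)[of G] deg pos poly_extremal_poly_0_neq_0[of a m]
    unfolding S_def[symmetric] q L by (simp add: G_def)
  have "poly_height G * real n = ln (S / sqrt (q * L))"
    unfolding poly_height_def S_def[symmetric] q L using deg pos by simp
  also have "\<dots> \<le> ln (sqrt ((real n + 1) * (real n / real (Suc a) * P)))"
    using le \<open>S / sqrt (q * L) \<ge> 1\<close> by (intro ln_mono) auto
  also have "\<dots> = (ln (real n + 1) + ln (real n / real (Suc a)) + ln P) / 2"
  proof -
    have *: "ln (sqrt (u * (v * w))) = (ln u + ln v + ln w) / 2" if "u > 0" "v > 0" "w > 0" for u v w :: real
      using that by (simp add: ln_sqrt ln_mult)
    show ?thesis
      by (rule *) (use pos in simp_all)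
  qed
  also have "ln P \<le> (real (Suc a))\<^sup>2 / real m"
  proof -
    have "P \<le> exp ((real (Suc a))\<^sup>2 / (real n - real (Suc a)))"
      unfolding P_def using assms by (intro fact_ratio_le_exp) simp
    then have "ln P \<le> (real (Suc a))\<^sup>2 / (real n - real (Suc a))"
      using pos by (metis ln_exp ln_mono)
    then show ?thesis by (simp add: n_def)
  qed
  finally show ?thesis
    by (simp add: G_def)
qed

lemma N_theta_sharp:
  assumes "c < sqrt 2"
  shows "\<exists>f. degree f \<ge> 1 \<and> poly f 0 \<noteq> 0 \<and> c * sqrt (poly_height f) * real (degree f) < real (N_theta \<theta> f)"
proof -
  \<comment> \<open>A negative \<open>c\<close> is replaced by 0, so that the comparison can be made
    between squares.\<close>
  define d where "d = max c 0"
  have d: "d \<ge> 0" "c \<le> d" "d\<^sup>2 < 2"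
    using assms power_strict_mono[of d "sqrt 2" 2] by (auto simp: d_def)
  \<comment> \<open>For \<open>n = k^3\<close> and \<open>b = k^2\<close>, this is the upper bound
    for \<open>n * H\<close> divided by \<open>b^2 / n = k\<close>. The last summand of the
    numerator grows like \<open>k\<close>, which gives the limit 1/2.\<close>
  define R where "R = (\<lambda>k::real. (ln (k ^ 3 + 1) + ln k + k ^ 4 / (k ^ 3 - k ^ 2)) / (2 * k))"
  have "(R \<longlongrightarrow> 1 / 2) at_top"
    unfolding R_def by real_asymp
  then have "((\<lambda>k. d\<^sup>2 * R (real k)) \<longlongrightarrow> d\<^sup>2 * (1 / 2)) sequentially"
    by (intro tendsto_mult tendsto_const) (rule filterlim_compose[OF _ filterlim_real_sequentially])
  then have "eventually (\<lambda>k. d\<^sup>2 * R (real k) < 1) sequentially"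
    by (rule order_tendstoD) (use d in simp)
  \<comment> \<open>The condition \<open>k \<ge> 2\<close> ensures \<open>k^2 < k^3\<close>, so that
    \<open>m\<close> is positive.\<close>
  then have "eventually (\<lambda>k. d\<^sup>2 * R (real k) < 1 \<and> k \<ge> 2) sequentially"
    using eventually_ge_at_top[of 2] by (rule eventually_conj)
  then obtain k where k: "d\<^sup>2 * R (real k) < 1" "k \<ge> 2"
    using eventually_happens by force
  define a where "a = k\<^sup>2 - 1"
  define m where "m = k ^ 3 - k\<^sup>2"
  have "k\<^sup>2 * 1 < k\<^sup>2 * k"
    using k(2) by (intro mult_strict_left_mono) auto
  then have lt: "k\<^sup>2 < k ^ 3" by (simp add: power3_eq_cube power2_eq_square)
  have Suc_a: "Suc a = k\<^sup>2" using k(2) by (simp add: a_def)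
  have m: "m > 0" "m + Suc a = k ^ 3" "real m = real k ^ 3 - real k ^ 2"
    using lt Suc_a by (auto simp: m_def of_nat_diff)
  define G where "G = extremal_poly a m"
  have deg: "degree G = k ^ 3" by (simp add: G_def degree_extremal_poly m(2) del: add_Suc_right)
  have G0: "poly G 0 \<noteq> 0" by (simp add: G_def poly_extremal_poly_0_neq_0)
  obtain f where f: "degree f = degree G" "poly f 0 = poly G 0" "poly_height f = poly_height G"
    "k\<^sup>2 \<le> N_theta \<theta> f"
  proof (rule rotate_root_at_1)
    show "G \<noteq> 0" using G0 by auto
    show "[:-1, 1:] ^ k\<^sup>2 dvd G"
      unfolding G_def extremal_poly_def Suc_a by (rule dvd_triv_left)
  qed
  have f1: "degree f \<ge> 1" "poly f 0 \<noteq> 0"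
    using f deg G0 k(2) by auto
  have kpos: "real k > 0" using k(2) by simp
  have "poly_height f * real k ^ 3
      \<le> (ln (real k ^ 3 + 1) + ln (real k ^ 3 / real k ^ 2) + (real k ^ 2)\<^sup>2 / (real k ^ 3 - real k ^ 2)) / 2"
    using poly_height_extremal_poly_le[OF m(1), of a]
    unfolding m(2) unfolding m(3) Suc_a f(3) G_def of_nat_power .
  also have "real k ^ 3 / real k ^ 2 = real k"
    using kpos by (simp add: power3_eq_cube power2_eq_square)
  also have "(ln (real k ^ 3 + 1) + ln (real k) + (real k ^ 2)\<^sup>2 / (real k ^ 3 - real k ^ 2)) / 2 = R (real k) * real k"
    using kpos by (simp add: R_def power_mult[symmetric])
  finally have H: "poly_height f * real k ^ 3 \<le> R (real k) * real k" .
  \<comment> \<open>The square splits as \<open>d^2 * (n * H) * n\<close>, so the bound for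
    \<open>n * H\<close> gives at most \<open>d^2 * R k * k^4\<close>, which is below
    \<open>k^4 = b^2\<close> by the choice of \<open>k\<close>.\<close>
  have "(d * sqrt (poly_height f) * real k ^ 3)\<^sup>2 = d\<^sup>2 * (poly_height f * real k ^ 3) * real k ^ 3"
    using poly_height_nonneg[OF f1] by (simp add: power_mult_distrib power2_eq_square mult_ac)
  also have "\<dots> \<le> d\<^sup>2 * (R (real k) * real k) * real k ^ 3"
    using H kpos by (intro mult_right_mono mult_left_mono) auto
  also have "\<dots> = (d\<^sup>2 * R (real k)) * real k ^ 4"
    by (simp add: power3_eq_cube power4_eq_xxxx mult_ac)
  also have "\<dots> < 1 * real k ^ 4"
    using k(1) kpos by (intro mult_strict_right_mono) auto
  also have "\<dots> = (real k ^ 2)\<^sup>2"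
    by (simp add: power_mult[symmetric])
  finally have "d * sqrt (poly_height f) * real k ^ 3 < real k ^ 2"
    by (rule power2_less_imp_less) simp
  moreover have "c * sqrt (poly_height f) * real k ^ 3 \<le> d * sqrt (poly_height f) * real k ^ 3"
    using d poly_height_nonneg[OF f1] by (intro mult_right_mono) auto
  moreover have "real k ^ 2 \<le> real (N_theta \<theta> f)"
    using f(4) by (metis of_nat_le_iff of_nat_power)
  ultimately have "c * sqrt (poly_height f) * real (degree f) < real (N_theta \<theta> f)"
    unfolding f(1) deg of_nat_power by linarith
  with f1 show ?thesis by blast
qed

theorem theorem1p2:
  shows "(\<forall>f :: complex poly. degree f \<ge> 1 \<and> poly f 0 \<noteq> 0 \<longrightarrow>
            (\<forall>\<theta>::real. real (N_theta \<theta> f) \<le> sqrt 2 * sqrt (poly_height f) * real (degree f))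
          \<and> real (N_pos f) \<le> sqrt 2 * sqrt (poly_height f) * real (degree f)
          \<and> real (N_neg f) \<le> sqrt 2 * sqrt (poly_height f) * real (degree f))
       \<and> (\<forall>c::real. c < sqrt 2 \<longrightarrow>
            (\<forall>\<theta>::real. \<exists>f :: complex poly. degree f \<ge> 1 \<and> poly f 0 \<noteq> 0 \<and>
                 c * sqrt (poly_height f) * real (degree f) < real (N_theta \<theta> f))
          \<and> (\<exists>f :: complex poly. degree f \<ge> 1 \<and> poly f 0 \<noteq> 0 \<and>
                 c * sqrt (poly_height f) * real (degree f) < real (N_pos f))
          \<and> (\<exists>f :: complex poly. degree f \<ge> 1 \<and> poly f 0 \<noteq> 0 \<and>
                 c * sqrt (poly_height f) * real (degree f) < real (N_neg f)))"
  unfolding N_pos_eq_N_theta N_neg_eq_N_theta using N_theta_le N_theta_sharp by blast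

end
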